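(* Let $n\ge1$ and let $\mathscr{H}(\lambda)=\sum_{k=1}^M\lambda_kH_k$ be an $n$-spin Hamiltonian model on $(\mathbb{C}^2)^{\otimes n}$, with $\mathcal{S}(\mathscr{H})$ the set of Pauli operators appearing in the model, and let $\varphi:\mathcal{P}_n\to(\mathbb{Z}_2)^{2n}$ be the binary vector representation. If the rank over $\mathbb{Z}_2$ of the set of vectors $\varphi(\mathcal{S}(\mathscr{H}))\subseteq(\mathbb{Z}_2)^{2n}$ (the dimension of its $\mathbb{Z}_2$-span) is less than $2n$, then there is a subspace $V$ with $\{0\}\ne V\ne(\mathbb{C}^2)^{\otimes n}$ and $\mathscr{H}(\lambda)V\subseteq V$ for all $\lambda\in\mathbb{R}^M$.
   Context: Let $\sigma_0=I_2$ and let $\sigma_1=\sigma_x,\sigma_2=\sigma_y,\sigma_3=\sigma_z$ be the Pauli matrices. Put $\mathcal{P}_n=\{\sigma_{j_1}\otimes\cdots\otimes\sigma_{j_n} : 0\le j_1,\dots,j_n\le3\}$ and $\mathcal{P}_n^*=\mathcal{P}_n\setminus\{I_{2^n}\}$. $\mathcal{P}_n$ is an abelian group under matrix multiplication modulo the scalars $\{\pm iI,\pm I\}$, and $\varphi:\mathcal{P}_n\to(\mathbb{Z}_2)^{2n}$ is a group isomorphism (e.g. the one obtained by concatenating over the $n$ tensor factors the assignment $I_2\mapsto(0,0)$, $\sigma_x\mapsto(0,1)$, $\sigma_y\mapsto(1,1)$, $\sigma_z\mapsto(1,0)$). An $n$-spin Hamiltonian model is a function $\mathscr{H}(\lambda)=\sum_{k=1}^M\lambda_kH_k$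 of $\lambda\in\mathbb{R}^M$ ($M\ge1$) where each $H_k$ is a fixed self-adjoint operator on $(\mathbb{C}^2)^{\otimes n}$ that is a linear combination of elements of $\mathcal{P}_n^*$. The set of Pauli operators appearing in the model is $\mathcal{S}(\mathscr{H})=\{\sigma\in\mathcal{P}_n^* : \mathrm{tr}(\sigma^\dagger H_k)\ne0 \text{ for some } k\}$, i.e. those with non-zero coefficient in the Pauli expansion of some $H_k$. *)

theory Defs
  imports
    "HOL-Library.Z2"
    "Jordan_Normal_Form.Schur_Decomposition"
    "Jordan_Normal_Form.DL_Rank"
begin

text \<open>The space \<open>(\<complex>\<^sup>2)\<^sup>\<otimes>\<^sup>n\<close> is identified with \<open>carrier_vec (2 ^ n)\<close>
  through the Kronecker product, the leftmost tensor factor being the most significant digit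
  of an index.\<close>

definition kronecker :: "complex mat \<Rightarrow> complex mat \<Rightarrow> complex mat" (infixr \<open>\<otimes>\<^sub>K\<close> 75) where
  "A \<otimes>\<^sub>K B = mat (dim_row A * dim_row B) (dim_col A * dim_col B)
     (\<lambda>(i, j). A $$ (i div dim_row B, j div dim_col B) * B $$ (i mod dim_row B, j mod dim_col B))"

fun kronecker_list :: "complex mat list \<Rightarrow> complex mat" where
  "kronecker_list [] = 1\<^sub>m 1"
| "kronecker_list (A # As) = A \<otimes>\<^sub>K kronecker_list As"

definition mat_trace :: "complex mat \<Rightarrow> complex" where
  "mat_trace A = (\<Sum>i<dim_row A. A $$ (i, i))"

definition pauli_matrix :: "nat \<Rightarrow> complex mat" where
  "pauli_matrix j =
    (if j = 0 then mat_of_rows_list 2 [[1, 0], [0, 1]]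
     else if j = 1 then mat_of_rows_list 2 [[0, 1], [1, 0]]
     else if j = 2 then mat_of_rows_list 2 [[0, - \<i>], [\<i>, 0]]
     else mat_of_rows_list 2 [[1, 0], [0, -1]])"

definition pauli_ops :: "nat \<Rightarrow> complex mat set" where
  "pauli_ops n = {kronecker_list (map pauli_matrix js) | js. length js = n \<and> set js \<subseteq> {0..3}}"

definition pauli_ops_star :: "nat \<Rightarrow> complex mat set" where
  "pauli_ops_star n = pauli_ops n - {1\<^sub>m (2 ^ n)}"

text \<open>Multiplication modulo the scalars \<open>\<plusminus>1, \<plusminus>\<i>\<close>: the product of two Pauli operators is
  represented by the unique Pauli operator that it is a scalar multiple of
  (see \<open>pauli_group_mult_eq\<close> below).\<close>

definition pauli_group :: "nat \<Rightarrow> complex mat monoid" where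
  "pauli_group n =
    \<lparr>carrier = pauli_ops n,
     monoid.mult = (\<lambda>A B. THE C. C \<in> pauli_ops n \<and> (\<exists>c \<in> {1, -1, \<i>, -\<i>}. A * B = c \<cdot>\<^sub>m C)),
     one = 1\<^sub>m (2 ^ n)\<rparr>"

text \<open>The coefficients of a model are indexed by \<open>k < M\<close> instead of \<open>1 \<le> k \<le> M\<close>.\<close>

definition hamiltonian_model :: "nat \<Rightarrow> nat \<Rightarrow> (nat \<Rightarrow> complex mat) \<Rightarrow> bool" where
  "hamiltonian_model n M H \<longleftrightarrow> M \<ge> 1 \<and>
     (\<forall>k<M. H k \<in> carrier_mat (2 ^ n) (2 ^ n) \<and> mat_adjoint (H k) = H k \<and>
        H k \<in> LinearCombinations.module.span class_ring
                 (module_mat TYPE(complex) (2 ^ n) (2 ^ n)) (pauli_ops_star n))"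

definition hamiltonian :: "nat \<Rightarrow> nat \<Rightarrow> (nat \<Rightarrow> complex mat) \<Rightarrow> real vec \<Rightarrow> complex mat" where
  "hamiltonian n M H l =
     finsum (module_mat TYPE(complex) (2 ^ n) (2 ^ n)) (\<lambda>k. complex_of_real (l $ k) \<cdot>\<^sub>m H k) {..<M}"

definition pauli_support :: "nat \<Rightarrow> nat \<Rightarrow> (nat \<Rightarrow> complex mat) \<Rightarrow> complex mat set" where
  "pauli_support n M H =
     {\<sigma> \<in> pauli_ops_star n. \<exists>k<M. mat_trace (mat_adjoint \<sigma> * H k) \<noteq> 0}"

definition span_rank :: "nat \<Rightarrow> bit vec set \<Rightarrow> nat" where
  "span_rank m X = vectorspace.dim class_ring
     ((module_vec TYPE(bit) m)
        \<lparr>carrier := LinearCombinations.module.span class_ring (module_vec TYPE(bit) m) X\<rparr>)"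

text \<open>The standard binary vector representation. It is shown below to be an isomorphism, so the
  notion of an isomorphism from \<open>pauli_group n\<close> onto \<open>monoid_vec TYPE(bit) (2 * n)\<close> is not void.\<close>

definition pauli_bits :: "nat \<Rightarrow> bit list" where
  "pauli_bits j = (if j = 0 then [0, 0] else if j = 1 then [0, 1] else if j = 2 then [1, 1] else [1, 0])"

definition standard_binary_rep :: "nat \<Rightarrow> complex mat \<Rightarrow> bit vec" where
  "standard_binary_rep n A = vec_of_list (concat (map pauli_bits
     (THE js. length js = n \<and> set js \<subseteq> {0..3} \<and> kronecker_list (map pauli_matrix js) = A)))"

lemma pauli_matrix_carrier[simp]: "pauli_matrix j \<in> carrier_mat 2 2"
  by (auto simp: pauli_matrix_def mat_of_rows_list_def)

lemma kronecker_carrier: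
  "A \<in> carrier_mat a b \<Longrightarrow> B \<in> carrier_mat c d \<Longrightarrow> A \<otimes>\<^sub>K B \<in> carrier_mat (a * c) (b * d)"
  by (auto simp: kronecker_def)

lemma sum_div_mod:
  fixes f :: "nat \<Rightarrow> nat \<Rightarrow> 'a::comm_monoid_add"
  assumes "b > 0"
  shows "(\<Sum>k<a*b. f (k div b) (k mod b)) = (\<Sum>i<a. \<Sum>j<b. f i j)"
proof -
  have "(\<Sum>i<a. \<Sum>j<b. f i j) = (\<Sum>(i,j)\<in>{..<a} \<times> {..<b}. f i j)"
    by (simp add: sum.cartesian_product)
  also have "\<dots> = (\<Sum>k<a*b. f (k div b) (k mod b))"
  proof (rule sum.reindex_bij_witness[where i="\<lambda>k. (k div b, k mod b)" and j="\<lambda>(i,j). i * b + j"])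
    fix p assume p: "p \<in> {..<a} \<times> {..<b}"
    then obtain i j where [simp]: "p = (i,j)" and ij: "i < a" "j < b" by auto
    have "i * b + j < Suc i * b" using ij by simp
    also have "\<dots> \<le> a * b" using ij by (intro mult_le_mono1) simp
    finally show "(case p of (i,j) \<Rightarrow> i * b + j) \<in> {..<a*b}" by simp
    show "((case p of (i,j) \<Rightarrow> i * b + j) div b, (case p of (i,j) \<Rightarrow> i * b + j) mod b) = p"
      using ij by simp
    show "f ((case p of (i,j) \<Rightarrow> i * b + j) div b) ((case p of (i,j) \<Rightarrow> i * b + j) mod b) = (case p of (i,j) \<Rightarrow> f i j)"
      using ij by simp
  next
    fix k assume "k \<in> {..<a*b}"
    then show "(k div b, k mod b) \<in> {..<a} \<times> {..<b}"
      using assms by (auto simp: less_mult_imp_div_less)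
  qed auto
  finally show ?thesis by simp
qed

lemma kronecker_mult:
  assumes A: "A \<in> carrier_mat a a" and B: "B \<in> carrier_mat b b"
    and C: "C \<in> carrier_mat a a" and D: "D \<in> carrier_mat b b" and b: "b > 0"
  shows "(A \<otimes>\<^sub>K B) * (C \<otimes>\<^sub>K D) = (A * C) \<otimes>\<^sub>K (B * D)"
proof (rule eq_matI)
  note dims = carrier_matD[OF A] carrier_matD[OF B] carrier_matD[OF C] carrier_matD[OF D]
  fix i j
  assume "i < dim_row ((A * C) \<otimes>\<^sub>K (B * D))" "j < dim_col ((A * C) \<otimes>\<^sub>K (B * D))"
  then have ij: "i < a * b" "j < a * b" using dims by (auto simp: kronecker_def)
  then have ij': "i div b < a" "j div b < a" "i mod b < b" "j mod b < b"
    using b by (auto simp: less_mult_imp_div_less)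
  have "((A \<otimes>\<^sub>K B) * (C \<otimes>\<^sub>K D)) $$ (i, j)
     = (\<Sum>k<a*b. (A $$ (i div b, k div b) * C $$ (k div b, j div b))
         * (B $$ (i mod b, k mod b) * D $$ (k mod b, j mod b)))"
    using ij dims by (simp add: kronecker_def scalar_prod_def lessThan_atLeast0 ac_simps)
  also have "\<dots> = (\<Sum>p<a. \<Sum>q<b. (A $$ (i div b, p) * C $$ (p, j div b))
         * (B $$ (i mod b, q) * D $$ (q, j mod b)))"
    by (rule sum_div_mod[OF b])
  also have "\<dots> = ((A * C) \<otimes>\<^sub>K (B * D)) $$ (i, j)"
    using ij ij' dims by (simp add: kronecker_def scalar_prod_def lessThan_atLeast0 sum_product)
  finally show "((A \<otimes>\<^sub>K B) * (C \<otimes>\<^sub>K D)) $$ (i, j) = ((A * C) \<otimes>\<^sub>K (B * D)) $$ (i, j)" .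
qed (use assms in \<open>auto simp: kronecker_def\<close>)

lemma mat_trace_kronecker:
  assumes A: "A \<in> carrier_mat a a" and B: "B \<in> carrier_mat b b" and b: "b > 0"
  shows "mat_trace (A \<otimes>\<^sub>K B) = mat_trace A * mat_trace B"
proof -
  have "mat_trace (A \<otimes>\<^sub>K B) = (\<Sum>k<a*b. A $$ (k div b, k div b) * B $$ (k mod b, k mod b))"
    using A B by (simp add: mat_trace_def kronecker_def)
  also have "\<dots> = (\<Sum>p<a. \<Sum>q<b. A $$ (p, p) * B $$ (q, q))"
    by (rule sum_div_mod[OF b])
  finally show ?thesis using A B by (simp add: mat_trace_def sum_product)
qed

lemma kronecker_smult:
  assumes "B \<in> carrier_mat b b" and "b > 0" and "A \<in> carrier_mat a a"
  shows "(c \<cdot>\<^sub>m A) \<otimes>\<^sub>K (d \<cdot>\<^sub>m B) = (c * d) \<cdot>\<^sub>m (A \<otimes>\<^sub>K B)"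
  using assms by (intro eq_matI) (auto simp: kronecker_def less_mult_imp_div_less)

lemma kronecker_one:
  assumes "m > 0"
  shows "1\<^sub>m 2 \<otimes>\<^sub>K 1\<^sub>m m = 1\<^sub>m (2 * m)"
proof (rule eq_matI)
  fix i j
  assume "i < dim_row (1\<^sub>m (2 * m) :: complex mat)" "j < dim_col (1\<^sub>m (2 * m) :: complex mat)"
  then have ij: "i < 2 * m" "j < 2 * m" by auto
  then have "i div m < 2" "j div m < 2" by (auto simp: less_mult_imp_div_less)
  moreover have "(i div m = j div m \<and> i mod m = j mod m) = (i = j)"
    by (metis div_mult_mod_eq)
  ultimately show "(1\<^sub>m 2 \<otimes>\<^sub>K 1\<^sub>m m) $$ (i, j) = 1\<^sub>m (2 * m) $$ (i, j)"
    using ij assms by (auto simp: kronecker_def)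
qed (auto simp: kronecker_def)

abbreviation pauli_string :: "nat list \<Rightarrow> complex mat" where
  "pauli_string js \<equiv> kronecker_list (map pauli_matrix js)"

lemma pauli_string_carrier: "pauli_string js \<in> carrier_mat (2 ^ length js) (2 ^ length js)"
  by (induction js) (auto intro: kronecker_carrier)

lemma lt4E: "(a::nat) \<in> {0..3} \<Longrightarrow> (a = 0 \<Longrightarrow> P) \<Longrightarrow> (a = 1 \<Longrightarrow> P) \<Longrightarrow> (a = 2 \<Longrightarrow> P) \<Longrightarrow> (a = 3 \<Longrightarrow> P) \<Longrightarrow> P"
  by force

lemma mat2_eqI:
  assumes "A \<in> carrier_mat 2 2" "B \<in> carrier_mat 2 2"
    "A $$ (0,0) = B $$ (0,0)" "A $$ (0,1) = B $$ (0,1)" "A $$ (1,0) = B $$ (1,0)" "A $$ (1,1) = B $$ (1,1)"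
  shows "A = B"
  using assms by (intro eq_matI) (auto simp: less_2_cases_iff)

lemma pauli_matrix_mult:
  assumes "a \<in> {0..3}" "b \<in> {0..3}"
  shows "\<exists>d\<in>{0..3}. \<exists>c\<in>{1, -1, \<i>, -\<i>}. pauli_matrix a * pauli_matrix b = c \<cdot>\<^sub>m pauli_matrix d
     \<and> pauli_bits d = map2 (+) (pauli_bits a) (pauli_bits b)
     \<and> (d = 0 \<longleftrightarrow> a = b)"
proof -
  define d where "d = (if a = 0 then b else if b = 0 then a else if a = b then 0 else 6 - a - b)"
  define c where "c = (if a = 0 \<or> b = 0 \<or> a = b then 1
     else if (a,b) \<in> {(1,2),(2,3),(3,1)} then \<i> else -\<i>)"
  have "pauli_matrix a * pauli_matrix b = c \<cdot>\<^sub>m pauli_matrix d"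
    by (rule mat2_eqI[OF mult_carrier_mat[OF pauli_matrix_carrier pauli_matrix_carrier]
          smult_carrier_mat[OF pauli_matrix_carrier]]; rule lt4E[OF assms(1)]; rule lt4E[OF assms(2)])
       (simp_all add: pauli_matrix_def mat_of_rows_list_def scalar_prod_def c_def d_def numeral_2_eq_2)
  moreover have "pauli_bits d = map2 (+) (pauli_bits a) (pauli_bits b) \<and> (d = 0 \<longleftrightarrow> a = b)"
    by (rule lt4E[OF assms(1)]; rule lt4E[OF assms(2)]) (simp_all add: d_def pauli_bits_def)
  moreover have "d \<in> {0..3}"
    by (rule lt4E[OF assms(1)]; rule lt4E[OF assms(2)]) (simp_all add: d_def)
  moreover have "c \<in> {1, -1, \<i>, -\<i>}" by (auto simp: c_def)
  ultimately show ?thesis by blast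
qed

lemma mat_trace_pauli_matrix: "a \<in> {0..3} \<Longrightarrow> mat_trace (pauli_matrix a) = (if a = 0 then 2 else 0)"
  by (erule lt4E) (simp_all add: mat_trace_def pauli_matrix_def mat_of_rows_list_def numeral_2_eq_2)

lemma smult_smult_eq: "a \<cdot>\<^sub>m (b \<cdot>\<^sub>m A) = (a * b) \<cdot>\<^sub>m (A :: complex mat)"
  by (intro eq_matI) auto

lemma one_smult_eq: "1 \<cdot>\<^sub>m A = (A :: complex mat)"
  by (intro eq_matI) auto

lemma mat_trace_smult: "A \<in> carrier_mat a a \<Longrightarrow> mat_trace (c \<cdot>\<^sub>m A) = c * mat_trace A"
  by (auto simp: mat_trace_def sum_distrib_left)

lemma pauli_string_mult:
  assumes "length as = length bs" "set as \<subseteq> {0..3}" "set bs \<subseteq> {0..3}"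
  shows "\<exists>ds. \<exists>c\<in>{1, -1, \<i>, -\<i>}. length ds = length as \<and> set ds \<subseteq> {0..3}
     \<and> pauli_string as * pauli_string bs = c \<cdot>\<^sub>m pauli_string ds
     \<and> concat (map pauli_bits ds) = map2 (+) (concat (map pauli_bits as)) (concat (map pauli_bits bs))
     \<and> (mat_trace (pauli_string ds) \<noteq> 0 \<longleftrightarrow> as = bs)
     \<and> (as = bs \<longrightarrow> c = 1 \<and> pauli_string ds = 1\<^sub>m (2 ^ length as))"
  using assms
proof (induction as bs rule: list_induct2)
  case Nil
  then show ?case by (intro exI[of _ "[]"] bexI[of _ 1]) (auto simp: mat_trace_def)
next
  case (Cons a as b bs)
  have pr: "set as \<subseteq> {0..3}" "set bs \<subseteq> {0..3}" "a \<in> {0..3}" "b \<in> {0..3}"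
    using Cons.prems by simp_all
  obtain ds c where ds: "length ds = length as" "set ds \<subseteq> {0..3}" "c \<in> {1, -1, \<i>, -\<i>}"
    "pauli_string as * pauli_string bs = c \<cdot>\<^sub>m pauli_string ds"
    "concat (map pauli_bits ds) = map2 (+) (concat (map pauli_bits as)) (concat (map pauli_bits bs))"
    "mat_trace (pauli_string ds) \<noteq> 0 \<longleftrightarrow> as = bs"
    "as = bs \<longrightarrow> c = 1 \<and> pauli_string ds = 1\<^sub>m (2 ^ length as)"
    using Cons.IH[OF pr(1,2)] by blast
  obtain d e where d: "d \<in> {0..3}" "e \<in> {1, -1, \<i>, -\<i>}"
    "pauli_matrix a * pauli_matrix b = e \<cdot>\<^sub>m pauli_matrix d"
    "pauli_bits d = map2 (+) (pauli_bits a) (pauli_bits b)" "d = 0 \<longleftrightarrow> a = b"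
    using pauli_matrix_mult[OF pr(3,4)] by blast
  have ca: "pauli_string as \<in> carrier_mat (2 ^ length as) (2 ^ length as)"
    "pauli_string bs \<in> carrier_mat (2 ^ length as) (2 ^ length as)"
    "pauli_string ds \<in> carrier_mat (2 ^ length as) (2 ^ length as)"
    using pauli_string_carrier[of as] pauli_string_carrier[of bs] pauli_string_carrier[of ds] Cons.hyps ds(1) by auto
  have 1: "pauli_string (a # as) * pauli_string (b # bs) = (e * c) \<cdot>\<^sub>m pauli_string (d # ds)"
    using kronecker_mult[OF pauli_matrix_carrier ca(1) pauli_matrix_carrier ca(2), of a b]
      kronecker_smult[OF ca(3) _ pauli_matrix_carrier, of e d c] ds(4) d(3) by simp
  have lb: "length (pauli_bits x) = 2" for x by (simp add: pauli_bits_def)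
  have 2: "concat (map pauli_bits (d # ds))
     = map2 (+) (concat (map pauli_bits (a # as))) (concat (map pauli_bits (b # bs)))"
    using ds(5) d(4) lb[of a] lb[of b] by simp
  have 3: "mat_trace (pauli_string (d # ds)) \<noteq> 0 \<longleftrightarrow> a # as = b # bs"
    using mat_trace_kronecker[OF pauli_matrix_carrier ca(3)] mat_trace_pauli_matrix[OF d(1)] ds(6) d(5)
    by simp
  have 4: "e * c = 1 \<and> pauli_string (d # ds) = 1\<^sub>m (2 ^ length (a # as))" if eq: "a # as = b # bs"
  proof -
    have d0: "d = 0" using d(5) eq by simp
    have p0: "pauli_matrix 0 = 1\<^sub>m 2"
      by (rule mat2_eqI[OF pauli_matrix_carrier one_carrier_mat]) (simp_all add: pauli_matrix_def mat_of_rows_list_def)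
    have "a \<in> {0..3}" using Cons.prems by simp
    then have "(pauli_matrix a * pauli_matrix a) $$ (0,0) = 1"
      by (elim lt4E) (simp_all add: pauli_matrix_def mat_of_rows_list_def scalar_prod_def numeral_2_eq_2)
    then have "e = 1" using d(3) eq d0 p0 by simp
    moreover have "c = 1" "pauli_string ds = 1\<^sub>m (2 ^ length as)"
      using ds(7) eq by auto
    ultimately show ?thesis using kronecker_one[of "2 ^ length as"] d0 p0 by simp
  qed
  have 5: "e * c \<in> {1, -1, \<i>, -\<i>}" using ds(3) d(2) by auto
  show ?case
    by (intro exI[of _ "d # ds"] bexI[OF _ 5] conjI impI)
      (use 1 2 3 4 ds(1,2) d(1) in auto)
qed

lemma pauli_string_inj:
  assumes "length as = length bs" "set as \<subseteq> {0..3}" "set bs \<subseteq> {0..3}"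
    and eq: "pauli_string as = c \<cdot>\<^sub>m pauli_string bs" and c: "c \<noteq> 0"
  shows "as = bs"
proof (rule ccontr)
  assume ne: "as \<noteq> bs"
  obtain ds e where ds: "length ds = length as"
    "pauli_string as * pauli_string bs = e \<cdot>\<^sub>m pauli_string ds" "mat_trace (pauli_string ds) = 0"
    using pauli_string_mult[OF assms(1-3)] ne by auto
  obtain es u where u: "pauli_string bs * pauli_string bs = u \<cdot>\<^sub>m pauli_string es"
     "mat_trace (pauli_string es) \<noteq> 0 \<longleftrightarrow> bs = bs" "bs = bs \<longrightarrow> u = 1 \<and> pauli_string es = 1\<^sub>m (2 ^ length bs)"
    using pauli_string_mult[OF refl assms(3) assms(3)] by blast
  have es: "pauli_string bs * pauli_string bs = 1 \<cdot>\<^sub>m pauli_string es"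
     "mat_trace (pauli_string es) \<noteq> 0"
    using u(1) u(3)[THEN mp, OF refl, THEN conjunct1] u(2)[THEN iffD2, OF refl] by (simp_all only: not_False_eq_True)
  have "pauli_string as * pauli_string bs = c \<cdot>\<^sub>m (1 \<cdot>\<^sub>m pauli_string es)"
    unfolding eq es(1)[symmetric]
    by (rule mult_smult_assoc_mat[OF pauli_string_carrier pauli_string_carrier])
  then have "mat_trace (e \<cdot>\<^sub>m pauli_string ds) = mat_trace (c \<cdot>\<^sub>m (1 \<cdot>\<^sub>m pauli_string es))"
    unfolding ds(2)[symmetric] by simp
  then have "e * mat_trace (pauli_string ds) = c * mat_trace (pauli_string es)"
    using mat_trace_smult[OF pauli_string_carrier] mat_trace_smult[OF smult_carrier_mat[OF pauli_string_carrier]]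
    by simp
  then show False using ds(3) es(2) c by simp
qed

lemma pauli_group_mult_eq:
  assumes "A \<in> pauli_ops n" "B \<in> pauli_ops n" "C \<in> pauli_ops n"
    and "c \<in> {1, -1, \<i>, -\<i>}" and "A * B = c \<cdot>\<^sub>m C"
  shows "A \<otimes>\<^bsub>pauli_group n\<^esub> B = C"
proof -
  have "C' = C" if C': "C' \<in> pauli_ops n" and c': "c' \<in> {1, -1, \<i>, -\<i>}" "A * B = c' \<cdot>\<^sub>m C'" for C' c'
  proof -
    obtain as bs where s: "C' = pauli_string as" "C = pauli_string bs" "length as = n" "length bs = n"
      "set as \<subseteq> {0..3}" "set bs \<subseteq> {0..3}"
      using C' assms(3) by (auto simp: pauli_ops_def)
    have z: "c \<noteq> 0" "c' \<noteq> 0" using assms(4) c' by auto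
    have eq: "c' \<cdot>\<^sub>m C' = c \<cdot>\<^sub>m C" using assms(5) c'(2) by simp
    have "inverse c' \<cdot>\<^sub>m (c' \<cdot>\<^sub>m C') = inverse c' \<cdot>\<^sub>m (c \<cdot>\<^sub>m C)" using eq by simp
    then have "C' = (inverse c' * c) \<cdot>\<^sub>m C"
      using z by (simp add: smult_smult_eq one_smult_eq)
    then show ?thesis using pauli_string_inj[of as bs "inverse c' * c"] s z by simp
  qed
  then show ?thesis using assms unfolding pauli_group_def by (auto intro!: the_equality)
qed

lemma standard_binary_rep_string:
  assumes "length js = n" "set js \<subseteq> {0..3}"
  shows "standard_binary_rep n (pauli_string js) = vec_of_list (concat (map pauli_bits js))"
proof -
  have "(THE ks. length ks = n \<and> set ks \<subseteq> {0..3} \<and> pauli_string ks = pauli_string js) = js"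
    using assms pauli_string_inj[of _ js 1] by (intro the_equality) (auto simp: one_smult_eq)
  then show ?thesis by (simp add: standard_binary_rep_def)
qed

lemma length_pauli_bits: "length (concat (map pauli_bits js)) = 2 * length js"
  by (induction js) (auto simp: pauli_bits_def)

lemma pauli_bits_inj:
  assumes "length as = length bs" "set as \<subseteq> {0..3}" "set bs \<subseteq> {0..3}"
    "concat (map pauli_bits as) = concat (map pauli_bits bs)"
  shows "as = bs"
  using assms
proof (induction as bs rule: list_induct2)
  case (Cons a as b bs)
  have "pauli_bits a = pauli_bits b \<and> concat (map pauli_bits as) = concat (map pauli_bits bs)"
  proof -
    have "length (pauli_bits a) = length (pauli_bits b)" by (simp add: pauli_bits_def)
    then show ?thesis using Cons.prems(3) by simp
  qed
  moreover have "a = b" if "pauli_bits a = pauli_bits b" "a \<in> {0..3}" "b \<in> {0..3}"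
    using that(1) by (simp add: pauli_bits_def split: if_splits; use that(2,3) in simp)
  ultimately show ?case using Cons by simp
qed simp

lemma pauli_bits_surj:
  "length bs = 2 * n \<Longrightarrow> \<exists>js. length js = n \<and> set js \<subseteq> {0..3} \<and> concat (map pauli_bits js) = bs"
proof (induction n arbitrary: bs)
  case (Suc n)
  then obtain x y bs' where bs: "bs = x # y # bs'" by (cases bs; cases "tl bs") auto
  obtain js where js: "length js = n" "set js \<subseteq> {0..3}" "concat (map pauli_bits js) = bs'"
    using Suc bs by auto
  define j :: nat where "j = (if x = 0 then (if y = 0 then 0 else 1) else if y = 0 then 3 else 2)"
  have j: "j \<in> {0..3}" "pauli_bits j = [x, y]"
    by (cases x; cases y; simp add: j_def pauli_bits_def)+
  then show ?case using bs js by (intro exI[of _ "j # js"]) simp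
qed simp

lemma standard_binary_rep_iso:
  "standard_binary_rep n \<in> iso (pauli_group n) (monoid_vec TYPE(bit) (2 * n))"
proof -
  let ?f = "standard_binary_rep n"
  have mem: "pauli_string js \<in> pauli_ops n" if "length js = n" "set js \<subseteq> {0..3}" for js
    using that by (auto simp: pauli_ops_def)
  have closed: "?f A \<in> carrier_vec (2 * n)" if A: "A \<in> pauli_ops n" for A
  proof -
    obtain js where "length js = n" "set js \<subseteq> {0..3}" "A = pauli_string js"
      using A by (auto simp: pauli_ops_def)
    then show ?thesis using standard_binary_rep_string[of js n] length_pauli_bits[of js]
      by (simp add: carrier_dim_vec)
  qed
  have mult: "?f (A \<otimes>\<^bsub>pauli_group n\<^esub> B) = ?f A + ?f B" if AB: "A \<in> pauli_ops n" "B \<in> pauli_ops n" for A B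
  proof -
    obtain as bs where s: "A = pauli_string as" "B = pauli_string bs" "length as = n" "length bs = n"
      "set as \<subseteq> {0..3}" "set bs \<subseteq> {0..3}" using AB by (auto simp: pauli_ops_def)
    obtain ds c where ds: "length ds = n" "set ds \<subseteq> {0..3}" "c \<in> {1, -1, \<i>, -\<i>}"
      "A * B = c \<cdot>\<^sub>m pauli_string ds"
      "concat (map pauli_bits ds) = map2 (+) (concat (map pauli_bits as)) (concat (map pauli_bits bs))"
      using pauli_string_mult[of as bs] s by auto
    have "A \<otimes>\<^bsub>pauli_group n\<^esub> B = pauli_string ds"
      by (rule pauli_group_mult_eq[OF AB mem[OF ds(1,2)] ds(3,4)])
    moreover have "vec_of_list (concat (map pauli_bits ds))
       = vec_of_list (concat (map pauli_bits as)) + vec_of_list (concat (map pauli_bits bs))"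
      unfolding ds(5) using length_pauli_bits[of as] length_pauli_bits[of bs] s(3,4)
      by (intro eq_vecI) (auto simp: vec_of_list_index)
    ultimately show ?thesis
      using s ds(1,2) by (simp add: standard_binary_rep_string)
  qed
  have inj: "inj_on ?f (pauli_ops n)"
  proof (rule inj_onI)
    fix A B assume AB: "A \<in> pauli_ops n" "B \<in> pauli_ops n" "?f A = ?f B"
    obtain as bs where s: "A = pauli_string as" "B = pauli_string bs" "length as = n" "length bs = n"
      "set as \<subseteq> {0..3}" "set bs \<subseteq> {0..3}" using AB by (auto simp: pauli_ops_def)
    have "concat (map pauli_bits as) = concat (map pauli_bits bs)"
      using AB(3) s by (metis standard_binary_rep_string list_vec)
    then show "A = B" using pauli_bits_inj[of as bs] s by simp
  qed
  have surj: "v \<in> ?f ` pauli_ops n" if v: "v \<in> carrier_vec (2 * n)" for v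
  proof -
    have "length (list_of_vec v) = 2 * n" using v by simp
    then obtain js where js: "length js = n" "set js \<subseteq> {0..3}" "concat (map pauli_bits js) = list_of_vec v"
      using pauli_bits_surj by blast
    then have "?f (pauli_string js) = v"
      by (simp add: standard_binary_rep_string vec_list)
    then show ?thesis using mem[OF js(1,2)] by blast
  qed
  have "bij_betw ?f (pauli_ops n) (carrier_vec (2 * n))"
    using inj closed surj by (auto simp: bij_betw_def)
  then show ?thesis
    using closed mult by (auto simp: iso_def hom_def pauli_group_def monoid_vec_def)
qed

end

theory Submission
  imports Defs
begin

text \<open>Fewer than \<open>2 n\<close> Pauli operators generate, up to scalars, a group containing the support of
  the model. Each of them commutes or anticommutes with any given Pauli operator, so these
  generators distinguish fewer than \<open>2 ^ (2 n)\<close> commutation patterns, and two distinct Pauli operators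
  must share one. Their product is, up to a scalar, a Pauli operator \<open>Q\<close> of trace zero with
  \<open>Q\<^sup>2 = 1\<close> that commutes with the generators and hence with the whole model; the eigenspace of
  \<open>Q\<close> for the eigenvalue 1 is the invariant subspace.\<close>

section \<open>Finite sums of matrices\<close>

lemma finsum_mat_insert:
  fixes f :: "'b \<Rightarrow> 'a::field mat"
  assumes "finite A" "x \<notin> A" "f \<in> insert x A \<rightarrow> carrier_mat nr nc"
  shows "finsum (module_mat TYPE('a) nr nc) f (insert x A) = f x + finsum (module_mat TYPE('a) nr nc) f A"
proof -
  interpret matrix_vs nr nc "TYPE('a)" .
  show ?thesis using assms by (intro finsum_insert) auto
qed

lemma finsum_mat_empty: "finsum (module_mat TYPE('a::field) nr nc) f {} = 0\<^sub>m nr nc"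
proof -
  interpret matrix_vs nr nc "TYPE('a)" .
  show ?thesis by simp
qed

lemma finsum_mat_closed:
  fixes f :: "'b \<Rightarrow> 'a::field mat"
  assumes "f \<in> A \<rightarrow> carrier_mat nr nc"
  shows "finsum (module_mat TYPE('a) nr nc) f A \<in> carrier_mat nr nc"
proof -
  interpret matrix_vs nr nc "TYPE('a)" .
  show ?thesis using assms by (rule finsum_closed)
qed

text \<open>The matrices commuting with \<open>Q\<close> are closed under sums. This is needed
  twice: for the Pauli expansion of a single \<open>H k\<close>, and for the sum over
  \<open>k\<close> that forms the Hamiltonian.\<close>

lemma commute_finsum_mat:
  fixes f :: "'b \<Rightarrow> 'a::field mat"
  assumes Q: "Q \<in> carrier_mat m m" and "finite A" and "f \<in> A \<rightarrow> carrier_mat m m"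
    and "\<And>x. x \<in> A \<Longrightarrow> Q * f x = f x * Q"
  shows "Q * finsum (module_mat TYPE('a) m m) f A = finsum (module_mat TYPE('a) m m) f A * Q"
  using assms(2-4)
proof (induction A rule: finite_induct)
  case empty
  then show ?case using Q by (simp add: finsum_mat_empty)
next
  case (insert x A)
  have f: "f x \<in> carrier_mat m m" "f \<in> A \<rightarrow> carrier_mat m m" using insert.prems by auto
  have "Q * finsum (module_mat TYPE('a) m m) f A = finsum (module_mat TYPE('a) m m) f A * Q"
    using insert.IH f(2) insert.prems(2) by auto
  then show ?case
    using insert.prems(2)[of x] finsum_mat_closed[OF f(2)] f(1) Q
    by (simp add: finsum_mat_insert[OF insert.hyps insert.prems(1)]
        mult_add_distrib_mat[of _ m m] add_mult_distrib_mat[of _ m m])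
qed

lemma mat_trace_add:
  "A \<in> carrier_mat m m \<Longrightarrow> B \<in> carrier_mat m m \<Longrightarrow> mat_trace (A + B) = mat_trace A + mat_trace B"
  by (auto simp: mat_trace_def sum.distrib)

text \<open>Linearity of the trace pairing; with a Pauli operator as \<open>X\<close> it extracts a
  coefficient from a Pauli expansion.\<close>

lemma mat_trace_mult_finsum:
  assumes X: "X \<in> carrier_mat m m" and "finite A" and "f \<in> A \<rightarrow> carrier_mat m m"
  shows "mat_trace (X * finsum (module_mat TYPE(complex) m m) f A) = (\<Sum>x\<in>A. mat_trace (X * f x))"
  using assms(2,3)
proof (induction A rule: finite_induct)
  case empty
  then show ?case using X by (simp add: finsum_mat_empty mat_trace_def)
next
  case (insert x A)
  have f: "f x \<in> carrier_mat m m" "f \<in> A \<rightarrow> carrier_mat m m" using insert.prems by auto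
  show ?case
    using insert.hyps insert.IH[OF f(2)] finsum_mat_closed[OF f(2)] f(1) X
    by (simp add: finsum_mat_insert[OF insert.hyps insert.prems] mult_add_distrib_mat[of _ m m]
        mat_trace_add[of _ m])
qed

section \<open>Pauli operators\<close>

lemma mat_adjoint_carrier: "A \<in> carrier_mat nr nc \<Longrightarrow> mat_adjoint A \<in> carrier_mat nc nr"
  by (auto simp: mat_adjoint_def)

lemma mat_adjoint_index:
  "i < dim_col A \<Longrightarrow> j < dim_row A \<Longrightarrow> mat_adjoint A $$ (i, j) = conjugate (A $$ (j, i))"
  by (simp add: mat_adjoint_def mat_of_rows_index)

lemma mat_adjoint_kronecker:
  assumes A: "A \<in> carrier_mat a b" and B: "B \<in> carrier_mat c d"
  shows "mat_adjoint (A \<otimes>\<^sub>K B) = mat_adjoint A \<otimes>\<^sub>K mat_adjoint B"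
proof (rule eq_matI)
  note car = mat_adjoint_carrier[OF A] mat_adjoint_carrier[OF B] kronecker_carrier[OF A B]
    mat_adjoint_carrier[OF kronecker_carrier[OF A B]]
  note dims = carrier_matD[OF A] carrier_matD[OF B] carrier_matD[OF car(1)] carrier_matD[OF car(2)]
    carrier_matD[OF car(3)] carrier_matD[OF car(4)]
  show "dim_row (mat_adjoint (A \<otimes>\<^sub>K B)) = dim_row (mat_adjoint A \<otimes>\<^sub>K mat_adjoint B)"
    "dim_col (mat_adjoint (A \<otimes>\<^sub>K B)) = dim_col (mat_adjoint A \<otimes>\<^sub>K mat_adjoint B)"
    unfolding dims by (simp_all add: kronecker_def dims)
  fix i j
  assume "i < dim_row (mat_adjoint A \<otimes>\<^sub>K mat_adjoint B)" "j < dim_col (mat_adjoint A \<otimes>\<^sub>K mat_adjoint B)"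
  then have ij: "i < b * d" "j < a * c" by (simp_all add: kronecker_def dims)
  \<comment> \<open>The index bounds exclude empty factors, so that \<open>div\<close> and
    \<open>mod\<close> by \<open>c\<close> and \<open>d\<close> stay in range.\<close>
  then have "c > 0" "d > 0" by (auto intro: gr0I)
  then have "i div d < b" "j div c < a" "i mod d < d" "j mod c < c"
    using ij by (auto simp: less_mult_imp_div_less)
  then show "mat_adjoint (A \<otimes>\<^sub>K B) $$ (i, j) = (mat_adjoint A \<otimes>\<^sub>K mat_adjoint B) $$ (i, j)"
    using ij by (simp add: mat_adjoint_index dims kronecker_def)
qed

lemma mat_adjoint_pauli_matrix: "mat_adjoint (pauli_matrix j) = pauli_matrix j"
  by (rule mat2_eqI[OF mat_adjoint_carrier[OF pauli_matrix_carrier] pauli_matrix_carrier])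
     (simp_all add: mat_adjoint_index carrier_matD[OF pauli_matrix_carrier],
      simp_all add: pauli_matrix_def mat_of_rows_list_def)

lemma mat_adjoint_pauli_string: "mat_adjoint (pauli_string js) = pauli_string js"
proof (induction js)
  case Nil
  have "mat_adjoint (1\<^sub>m 1 :: complex mat) \<in> carrier_mat 1 1"
    by (rule mat_adjoint_carrier) simp
  then show ?case by (intro eq_matI) (auto simp: mat_adjoint_index)
next
  case (Cons j js)
  then show ?case
    by (simp add: mat_adjoint_kronecker[OF pauli_matrix_carrier pauli_string_carrier]
        mat_adjoint_pauli_matrix)
qed

lemma pauli_opsE:
  assumes "A \<in> pauli_ops n"
  obtains js where "length js = n" "set js \<subseteq> {0..3}" "A = pauli_string js"
  using assms by (auto simp: pauli_ops_def)

lemma pauli_ops_carrier: "A \<in> pauli_ops n \<Longrightarrow> A \<in> carrier_mat (2 ^ n) (2 ^ n)"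
  by (elim pauli_opsE) (use pauli_string_carrier in blast)

text \<open>Self-adjointness removes the adjoint from the trace condition in
  \<open>pauli_support\<close>.\<close>

lemma pauli_ops_adjoint: "A \<in> pauli_ops n \<Longrightarrow> mat_adjoint A = A"
  by (elim pauli_opsE) (simp add: mat_adjoint_pauli_string)

lemma finite_pauli_ops: "finite (pauli_ops n)"
proof -
  have "pauli_ops n = pauli_string ` {js. set js \<subseteq> {0..3} \<and> length js = n}"
    by (auto simp: pauli_ops_def)
  then show ?thesis by (simp add: finite_lists_length_eq)
qed

section \<open>Products and traces of Pauli operators\<close>

lemma pauli_ops_square:
  assumes "A \<in> pauli_ops n"
  shows "A * A = 1\<^sub>m (2 ^ n)"
proof -
  obtain js where js: "length js = n" "set js \<subseteq> {0..3}" "A = pauli_string js"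
    using assms by (rule pauli_opsE)
  show ?thesis using pauli_string_mult[OF refl js(2) js(2)] js(1,3) by (auto simp: one_smult_eq)
qed

text \<open>Distinct strings differ in some tensor factor. There the product is a multiple of a
  non-identity Pauli matrix, which has trace zero, and the trace is multiplicative over tensor
  factors.\<close>

lemma pauli_ops_mult:
  assumes "A \<in> pauli_ops n" "B \<in> pauli_ops n"
  obtains C c where "C \<in> pauli_ops n" "c \<in> {1, -1, \<i>, -\<i>}" "A * B = c \<cdot>\<^sub>m C"
    "A \<noteq> B \<Longrightarrow> mat_trace C = 0"
proof -
  obtain as where as: "length as = n" "set as \<subseteq> {0..3}" "A = pauli_string as"
    using assms(1) by (rule pauli_opsE)
  obtain bs where bs: "length bs = n" "set bs \<subseteq> {0..3}" "B = pauli_string bs"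
    using assms(2) by (rule pauli_opsE)
  obtain ds c where ds: "length ds = n" "set ds \<subseteq> {0..3}" "c \<in> {1, -1, \<i>, -\<i>}"
    "A * B = c \<cdot>\<^sub>m pauli_string ds" "mat_trace (pauli_string ds) \<noteq> 0 \<longleftrightarrow> as = bs"
    using pauli_string_mult[of as bs] as bs by auto
  show ?thesis
  proof (rule that[of "pauli_string ds" c])
    show "pauli_string ds \<in> pauli_ops n" using ds(1,2) by (auto simp: pauli_ops_def)
    show "mat_trace (pauli_string ds) = 0" if "A \<noteq> B" using that ds(5) as(3) bs(3) by blast
  qed (use ds in auto)
qed

text \<open>Orthogonality of the Pauli operators for the trace form; \<open>2 ^ n\<close> is the
  trace of the identity.\<close>

lemma pauli_ops_trace_mult:
  assumes "A \<in> pauli_ops n" "B \<in> pauli_ops n"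
  shows "mat_trace (A * B) = (if A = B then 2 ^ n else 0)"
proof (cases "A = B")
  case True
  then show ?thesis using pauli_ops_square[OF assms(1)] by (simp add: mat_trace_def)
next
  case False
  obtain C c where "C \<in> pauli_ops n" "A * B = c \<cdot>\<^sub>m C" "mat_trace C = 0"
    using pauli_ops_mult[OF assms] False by metis
  then show ?thesis using False mat_trace_smult[OF pauli_ops_carrier] by simp
qed

section \<open>Commutation signs\<close>

lemma pauli_matrix_commute_or_anticommute:
  assumes "a \<in> {0..3}" "b \<in> {0..3}"
  shows "\<exists>e\<in>{1, -1}. pauli_matrix a * pauli_matrix b = e \<cdot>\<^sub>m (pauli_matrix b * pauli_matrix a)"
proof -
  \<comment> \<open>The identity commutes with everything, and two distinct non-identity Pauli
    matrices anticommute.\<close>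
  define e :: complex where "e = (if a = 0 \<or> b = 0 \<or> a = b then 1 else -1)"
  have "pauli_matrix a * pauli_matrix b = e \<cdot>\<^sub>m (pauli_matrix b * pauli_matrix a)"
    by (rule mat2_eqI[OF mult_carrier_mat[OF pauli_matrix_carrier pauli_matrix_carrier]
          smult_carrier_mat[OF mult_carrier_mat[OF pauli_matrix_carrier pauli_matrix_carrier]]];
        rule lt4E[OF assms(1)]; rule lt4E[OF assms(2)])
       (simp_all add: pauli_matrix_def mat_of_rows_list_def scalar_prod_def e_def numeral_2_eq_2)
  then show ?thesis by (auto simp: e_def)
qed

text \<open>Kronecker products multiply factor by factor, so the sign of a pair of strings is the
  product of the signs of its tensor factors.\<close>

lemma pauli_string_commute_or_anticommute:
  assumes "length as = length bs" "set as \<subseteq> {0..3}" "set bs \<subseteq> {0..3}"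
  shows "\<exists>e\<in>{1, -1}. pauli_string as * pauli_string bs = e \<cdot>\<^sub>m (pauli_string bs * pauli_string as)"
  using assms
proof (induction as bs rule: list_induct2)
  case Nil
  show ?case by (auto simp: one_smult_eq)
next
  case (Cons a as b bs)
  obtain e where e: "e \<in> {1, -1}"
    "pauli_string as * pauli_string bs = e \<cdot>\<^sub>m (pauli_string bs * pauli_string as)"
    using Cons by auto
  obtain d where d: "d \<in> {1, -1}"
    "pauli_matrix a * pauli_matrix b = d \<cdot>\<^sub>m (pauli_matrix b * pauli_matrix a)"
    using pauli_matrix_commute_or_anticommute[of a b] Cons.prems by auto
  have ca: "pauli_string as \<in> carrier_mat (2 ^ length as) (2 ^ length as)"
    "pauli_string bs \<in> carrier_mat (2 ^ length as) (2 ^ length as)"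
    using pauli_string_carrier[of as] pauli_string_carrier[of bs] Cons.hyps by auto
  have "pauli_string (a # as) * pauli_string (b # bs)
      = (d * e) \<cdot>\<^sub>m (pauli_string (b # bs) * pauli_string (a # as))"
    using kronecker_mult[OF pauli_matrix_carrier ca(1) pauli_matrix_carrier ca(2), of a b]
      kronecker_mult[OF pauli_matrix_carrier ca(2) pauli_matrix_carrier ca(1), of b a]
      kronecker_smult[OF mult_carrier_mat[OF ca(2,1)] _
        mult_carrier_mat[OF pauli_matrix_carrier pauli_matrix_carrier], of d b a e]
    by (simp add: e(2) d(2))
  moreover have "d * e \<in> {1, -1}" using d(1) e(1) by auto
  ultimately show ?case by blast
qed

lemma pauli_ops_commute_or_anticommute:
  assumes "A \<in> pauli_ops n" "B \<in> pauli_ops n"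
  shows "A * B = B * A \<or> A * B = (-1) \<cdot>\<^sub>m (B * A)"
proof -
  obtain as where as: "length as = n" "set as \<subseteq> {0..3}" "A = pauli_string as"
    using assms(1) by (rule pauli_opsE)
  obtain bs where bs: "length bs = n" "set bs \<subseteq> {0..3}" "B = pauli_string bs"
    using assms(2) by (rule pauli_opsE)
  show ?thesis
    using pauli_string_commute_or_anticommute[of as bs] as bs by (auto simp: one_smult_eq)
qed

section \<open>Operators that commute with a given set of Pauli operators\<close>

lemma smult_mat_cancel:
  fixes A B :: "complex mat"
  assumes "c \<cdot>\<^sub>m A = c \<cdot>\<^sub>m B" "c \<noteq> 0"
  shows "A = B"
proof -
  have "inverse c \<cdot>\<^sub>m (c \<cdot>\<^sub>m A) = inverse c \<cdot>\<^sub>m (c \<cdot>\<^sub>m B)" using assms(1) by simp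
  then show ?thesis using assms(2) by (simp add: smult_smult_eq one_smult_eq)
qed

text \<open>Moving \<open>X\<close> past \<open>B\<close> and then past \<open>A\<close> costs one
  factor \<open>e\<close> each time, and the two factors cancel.\<close>

lemma product_commutes_if_same_sign:
  fixes A B X :: "complex mat"
  assumes car: "A \<in> carrier_mat m m" "B \<in> carrier_mat m m" "X \<in> carrier_mat m m"
    and "A * X = e \<cdot>\<^sub>m (X * A)" "B * X = e \<cdot>\<^sub>m (X * B)" "e * e = 1"
  shows "(A * B) * X = X * (A * B)"
proof -
  have "(A * B) * X = A * (B * X)" using car by (rule assoc_mult_mat)
  also have "\<dots> = e \<cdot>\<^sub>m (A * (X * B))"
    unfolding assms(5) by (rule mult_smult_distrib[OF car(1) mult_carrier_mat[OF car(3,2)]])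
  also have "A * (X * B) = (A * X) * B" using car by (simp add: assoc_mult_mat)
  also have "\<dots> = e \<cdot>\<^sub>m ((X * A) * B)"
    unfolding assms(4) by (rule mult_smult_assoc_mat[OF mult_carrier_mat[OF car(3,1)] car(2)])
  also have "(X * A) * B = X * (A * B)" using car by (simp add: assoc_mult_mat)
  finally show ?thesis using assms(6) by (simp add: smult_smult_eq one_smult_eq)
qed

text \<open>Discards a phase: a product of Pauli operators is only a multiple of a Pauli operator,
  and commutation has to pass to the latter.\<close>

lemma commute_smultD:
  fixes Q X :: "complex mat"
  assumes "Q \<in> carrier_mat m m" "X \<in> carrier_mat m m" "c \<noteq> 0"
    and "(c \<cdot>\<^sub>m Q) * X = X * (c \<cdot>\<^sub>m Q)"
  shows "Q * X = X * Q"
  using assms(4) mult_smult_assoc_mat[OF assms(1,2)] mult_smult_distrib[OF assms(2,1)]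
    smult_mat_cancel[OF _ assms(3)] by metis

text \<open>Pigeonhole: at most \<open>2 ^ card \<B>\<close> commutation patterns stand against
  \<open>2 ^ (2 * n)\<close> Pauli operators. That two colliding operators are distinct is what
  makes the trace of \<open>Q\<close> vanish.\<close>

lemma exists_pauli_commuting:
  assumes "finite \<B>" "\<B> \<subseteq> pauli_ops n" "card \<B> < 2 * n"
    and card: "card (pauli_ops n) = 2 ^ (2 * n)"
  obtains Q where "Q \<in> pauli_ops n" "mat_trace Q = 0" "\<And>X. X \<in> \<B> \<Longrightarrow> Q * X = X * Q"
proof -
  \<comment> \<open>Only the signs 1 and -1 occur, so the set of elements of \<open>\<B>\<close>
    commuting with \<open>A\<close> determines the sign at every element of
    \<open>\<B>\<close>.\<close>
  define pattern where "pattern A = {X \<in> \<B>. A * X = X * A}" for A :: "complex mat"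
  have "card (pattern ` pauli_ops n) \<le> card (Pow \<B>)"
    using assms(1) by (intro card_mono) (auto simp: pattern_def)
  also have "\<dots> < card (pauli_ops n)"
    using assms(1,3) by (simp add: card card_Pow)
  finally have "\<not> inj_on pattern (pauli_ops n)" by (rule pigeonhole)
  then obtain A B where AB: "A \<in> pauli_ops n" "B \<in> pauli_ops n" "A \<noteq> B" "pattern A = pattern B"
    by (auto simp: inj_on_def)
  obtain Q c where Q: "Q \<in> pauli_ops n" "c \<in> {1, -1, \<i>, -\<i>}" "A * B = c \<cdot>\<^sub>m Q" "mat_trace Q = 0"
    using pauli_ops_mult[OF AB(1,2)] AB(3) by metis
  have "Q * X = X * Q" if X: "X \<in> \<B>" for X
  proof -
    have Xp: "X \<in> pauli_ops n" using X assms(2) by blast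
    have same: "A * X = X * A \<longleftrightarrow> B * X = X * B"
      using AB(4) X by (auto simp: pattern_def)
    \<comment> \<open>Equal patterns give \<open>A\<close> and \<open>B\<close> a common sign at
      \<open>X\<close>, hence a sign that squares to 1.\<close>
    have "\<exists>e. e * e = 1 \<and> A * X = e \<cdot>\<^sub>m (X * A) \<and> B * X = e \<cdot>\<^sub>m (X * B)"
    proof (cases "A * X = X * A")
      case True
      then show ?thesis using same by (intro exI[of _ 1]) (simp add: one_smult_eq)
    next
      case False
      then show ?thesis
        using same pauli_ops_commute_or_anticommute[OF AB(1) Xp]
          pauli_ops_commute_or_anticommute[OF AB(2) Xp] by (intro exI[of _ "-1"]) auto
    qed
    then have "(A * B) * X = X * (A * B)"
      using product_commutes_if_same_sign[of A "2 ^ n" B X] pauli_ops_carrier AB(1,2) Xp by blast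
    then show ?thesis
      using commute_smultD[OF pauli_ops_carrier[OF Q(1)] pauli_ops_carrier[OF Xp], of c] Q(2,3)
      by auto
  qed
  then show ?thesis using that Q(1,4) by blast
qed

section \<open>Binary representations\<close>

lemma carrier_pauli_group: "carrier (pauli_group n) = pauli_ops n"
  by (simp add: pauli_group_def)

text \<open>The isomorphism is a bijection onto the bit vectors of length \<open>2 * n\<close>,
  which are counted as bit lists.\<close>

lemma card_pauli_ops:
  assumes "\<phi> \<in> iso (pauli_group n) (monoid_vec TYPE(bit) (2 * n))"
  shows "card (pauli_ops n) = 2 ^ (2 * n)"
proof -
  have "bij_betw \<phi> (pauli_ops n) (carrier_vec (2 * n))"
    using assms by (simp add: iso_def carrier_pauli_group monoid_vec_def)
  then have "card (pauli_ops n) = card (carrier_vec (2 * n) :: bit vec set)"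
    by (rule bij_betw_same_card)
  also have "\<dots> = card {bs :: bit list. set bs \<subseteq> UNIV \<and> length bs = 2 * n}"
  proof (rule bij_betw_same_card[of list_of_vec], rule bij_betw_byWitness[of _ vec_of_list])
    show "vec_of_list ` {bs :: bit list. set bs \<subseteq> UNIV \<and> length bs = 2 * n} \<subseteq> carrier_vec (2 * n)"
      by (auto intro: carrier_vecI)
  qed (auto simp: vec_list list_vec)
  also have "\<dots> = 2 ^ (2 * n)"
  proof -
    have "x \<in> {0, 1}" for x :: bit by (cases x) simp_all
    then have U: "(UNIV :: bit set) = {0, 1}" by blast
    have "finite (UNIV :: bit set)" "card (UNIV :: bit set) = 2" unfolding U by simp_all
    then show ?thesis using card_lists_length_eq[of "UNIV :: bit set" "2 * n"] by simp
  qed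
  finally show ?thesis .
qed

text \<open>Turns the rank into a number of generators. These form a basis of the span of
  \<open>X\<close>, so they lie in that span but need not belong to \<open>X\<close>.\<close>

lemma span_rank_basis:
  assumes "finite X" "X \<subseteq> carrier_vec m"
  obtains B where "finite B" "card B = span_rank m X" "B \<subseteq> carrier_vec m"
    "X \<subseteq> LinearCombinations.module.span class_ring (module_vec TYPE(bit) m) B"
proof -
  interpret vec_space "TYPE(bit)" m .
  have sub: "VectorSpace.subspace class_ring (span X) V" using span_is_subspace assms(2) by simp
  have vs: "vectorspace class_ring (vs (span X))" by (rule subspace_is_vs[OF sub])
  have subm: "LinearCombinations.submodule class_ring (span X) V" using span_is_submodule assms(2) by simp
  obtain B where B: "finite B" "vectorspace.basis class_ring (vs (span X)) B"
    using vectorspace.finite_basis_exists[OF vs fin_dim_span] assms by auto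
  have BX: "B \<subseteq> span X"
    using B(2) unfolding vectorspace.basis_def[OF vs] by simp
  have "LinearCombinations.module.span class_ring (vs (span X)) B = span X"
    using B(2) unfolding vectorspace.basis_def[OF vs] by simp
  \<comment> \<open>\<open>B\<close> is a basis of the span regarded as a vector space of its own;
    linear combinations formed there agree with those of the ambient space.\<close>
  then have spanB: "span B = span X" unfolding span_li_not_depend(1)[OF BX subm] .
  have X: "X \<subseteq> span X" using in_own_span assms(2) by simp
  have carX: "span X \<subseteq> carrier_vec m" using span_is_subset2 assms(2) by simp
  show ?thesis
  proof (rule that[OF B(1)])
    show "card B = span_rank m X"
      unfolding span_rank_def using vectorspace.dim_basis[OF vs B] by simp
    show "B \<subseteq> carrier_vec m" using BX carX by (rule subset_trans)
    show "X \<subseteq> span B" unfolding spanB by (rule X)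
  qed
qed

text \<open>The only scalars are 0 and 1, so a set of vectors that contains zero and is closed under
  addition is already a submodule.\<close>

lemma span_bit_vec_induct:
  assumes "v \<in> LinearCombinations.module.span class_ring (module_vec TYPE(bit) m) B"
    and "B \<subseteq> carrier_vec m"
    and "P (0\<^sub>v m)" "\<And>b. b \<in> B \<Longrightarrow> P b"
    and add: "\<And>v w. v \<in> carrier_vec m \<Longrightarrow> w \<in> carrier_vec m \<Longrightarrow> P v \<Longrightarrow> P w \<Longrightarrow> P (v + w)"
  shows "P v"
proof -
  interpret vec_space "TYPE(bit)" m .
  have "LinearCombinations.submodule class_ring {v \<in> carrier_vec m. P v} V"
  proof (rule LinearCombinations.submodule.intro)
    show "Module.module class_ring V" by (rule vec_module)
    show "c \<odot>\<^bsub>V\<^esub> v \<in> {v \<in> carrier_vec m. P v}"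
      if "v \<in> {v \<in> carrier_vec m. P v}" for c v
      using that assms(3) by (cases c) auto
  qed (use assms(3) add in auto)
  then have "span B \<subseteq> {v \<in> carrier_vec m. P v}"
    using assms(2,4) by (intro span_is_subset) auto
  then show ?thesis using assms(1) by auto
qed

text \<open>A basis of the span of \<open>\<phi>\<close>
  S\<open>is pulled back to fewer than\<close>2 * n\<open>Pauli operators, and\<close>Q\<open>is
  chosen to commute with these. The vectors whose preimage commutes with\<close>Q\<open>contain zero
  and the basis and are closed under addition, so they contain all of\<close>\<phi>
  \<open>S\<close>.\<close>

lemma exists_pauli_commuting_support:
  assumes iso: "\<phi> \<in> iso (pauli_group n) (monoid_vec TYPE(bit) (2 * n))"
    and S: "S \<subseteq> pauli_ops n" and rank: "span_rank (2 * n) (\<phi> ` S) < 2 * n"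
  obtains Q where "Q \<in> pauli_ops n" "mat_trace Q = 0" "\<And>X. X \<in> S \<Longrightarrow> Q * X = X * Q"
proof -
  have bij: "bij_betw \<phi> (pauli_ops n) (carrier_vec (2 * n))"
    using iso by (simp add: iso_def carrier_pauli_group monoid_vec_def)
  have hom: "\<phi> (A \<otimes>\<^bsub>pauli_group n\<^esub> B) = \<phi> A + \<phi> B" if "A \<in> pauli_ops n" "B \<in> pauli_ops n" for A B
    using iso that by (auto simp: iso_def hom_def carrier_pauli_group monoid_vec_def)
  define \<psi> where "\<psi> = the_inv_into (pauli_ops n) \<phi>"
  have \<psi>: "\<psi> v \<in> pauli_ops n" "\<phi> (\<psi> v) = v" if "v \<in> carrier_vec (2 * n)" for v
    using bij that unfolding \<psi>_def bij_betw_def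
    by (auto intro: the_inv_into_into f_the_inv_into_f)
  have \<psi>\<phi>: "\<psi> (\<phi> A) = A" if "A \<in> pauli_ops n" for A
    using bij that unfolding \<psi>_def bij_betw_def by (auto intro: the_inv_into_f_f)
  have "\<phi> ` S \<subseteq> carrier_vec (2 * n)" using bij S unfolding bij_betw_def by blast
  moreover have "finite (\<phi> ` S)" using S finite_pauli_ops finite_subset by blast
  ultimately obtain B where B: "finite B" "card B = span_rank (2 * n) (\<phi> ` S)"
    "B \<subseteq> carrier_vec (2 * n)"
    "\<phi> ` S \<subseteq> LinearCombinations.module.span class_ring (module_vec TYPE(bit) (2 * n)) B"
    using span_rank_basis by metis
  have "card (\<psi> ` B) < 2 * n" using card_image_le[OF B(1), of \<psi>] B(2) rank by simp
  then obtain Q where Q: "Q \<in> pauli_ops n" "mat_trace Q = 0"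
    "\<And>X. X \<in> \<psi> ` B \<Longrightarrow> Q * X = X * Q"
    using exists_pauli_commuting[of "\<psi> ` B" n] B(1,3) \<psi>(1) card_pauli_ops[OF iso] by blast
  note carQ = pauli_ops_carrier[OF Q(1)]
  \<comment> \<open>Commutation with \<open>X\<close> and \<open>Y\<close> passes to the Pauli
    operator \<open>C\<close> that represents their product in the group.\<close>
  have mult: "Q * C = C * Q"
    if "X \<in> pauli_ops n" "Y \<in> pauli_ops n" "Q * X = X * Q" "Q * Y = Y * Q"
      "C \<in> pauli_ops n" "c \<in> {1, -1, \<i>, -\<i>}" "X * Y = c \<cdot>\<^sub>m C" for X Y C c
  proof -
    note car = pauli_ops_carrier[OF that(1)] pauli_ops_carrier[OF that(2)]
    have "(X * Y) * Q = Q * (X * Y)"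
      using product_commutes_if_same_sign[OF car carQ, of 1] that(3,4) by (simp add: one_smult_eq)
    then show ?thesis
      using commute_smultD[OF pauli_ops_carrier[OF that(5)] carQ, of c] that(6,7) by auto
  qed
  have add: "Q * \<psi> (v + w) = \<psi> (v + w) * Q"
    if vw: "v \<in> carrier_vec (2 * n)" "w \<in> carrier_vec (2 * n)"
      "Q * \<psi> v = \<psi> v * Q" "Q * \<psi> w = \<psi> w * Q" for v w
  proof -
    obtain C c where C: "C \<in> pauli_ops n" "c \<in> {1, -1, \<i>, -\<i>}" "\<psi> v * \<psi> w = c \<cdot>\<^sub>m C"
      using pauli_ops_mult[OF \<psi>(1)[OF vw(1)] \<psi>(1)[OF vw(2)]] by metis
    \<comment> \<open>The group product of \<open>\<psi> v\<close> and \<open>\<psi> w\<close> is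
      \<open>C\<close>, and \<open>\<phi>\<close> turns it into a sum.\<close>
    have "\<phi> C = v + w"
      using pauli_group_mult_eq[OF \<psi>(1)[OF vw(1)] \<psi>(1)[OF vw(2)] C]
        hom[OF \<psi>(1)[OF vw(1)] \<psi>(1)[OF vw(2)]] \<psi>(2) vw(1,2) by simp
    then have "\<psi> (v + w) = C" using \<psi>\<phi>[OF C(1)] by simp
    then show ?thesis using mult[OF \<psi>(1)[OF vw(1)] \<psi>(1)[OF vw(2)] vw(3,4) C] by simp
  qed
  \<comment> \<open>In characteristic 2 the zero vector is \<open>\<phi> Q + \<phi> Q\<close>, and
    \<open>Q\<close> commutes with itself, so closure under addition covers this case.\<close>
  have zero: "Q * \<psi> (0\<^sub>v (2 * n)) = \<psi> (0\<^sub>v (2 * n)) * Q"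
  proof -
    have "\<phi> Q \<in> carrier_vec (2 * n)" using bij Q(1) unfolding bij_betw_def by blast
    moreover from this have "\<phi> Q + \<phi> Q = 0\<^sub>v (2 * n)" by (intro eq_vecI) auto
    ultimately show ?thesis using add[of "\<phi> Q" "\<phi> Q"] \<psi>\<phi>[OF Q(1)] by simp
  qed
  have "Q * X = X * Q" if X: "X \<in> S" for X
  proof -
    have "Q * \<psi> (\<phi> X) = \<psi> (\<phi> X) * Q"
      by (rule span_bit_vec_induct[where P = "\<lambda>v. Q * \<psi> v = \<psi> v * Q", OF _ B(3) zero])
         (use B(4) X Q(3) add in auto)
    then show ?thesis using \<psi>\<phi> X S by auto
  qed
  then show ?thesis using that Q(1,2) by blast
qed

section \<open>The invariant subspace\<close>

lemma mat_eqI_mult_vec: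
  fixes A B :: "'a::comm_ring_1 mat"
  assumes "A \<in> carrier_mat nr nc" "B \<in> carrier_mat nr nc"
    and "\<And>v. v \<in> carrier_vec nc \<Longrightarrow> A *\<^sub>v v = B *\<^sub>v v"
  shows "A = B"
proof (rule eq_matI)
  fix i j assume ij: "i < dim_row B" "j < dim_col B"
  then have "(A *\<^sub>v unit_vec nc j) $ i = (B *\<^sub>v unit_vec nc j) $ i"
    using assms by simp
  then show "A $$ (i, j) = B $$ (i, j)"
    using ij assms(1,2) by simp
qed (use assms in auto)

text \<open>If every vector is fixed, \<open>Q\<close> is the identity; if only zero is fixed,
  \<open>Q\<close> is minus the identity. The traces \<open>m\<close> and \<open>-m\<close> both
  contradict trace zero.\<close>

lemma involution_eigenspace:
  assumes Q: "Q \<in> carrier_mat m m" and sq: "Q * Q = 1\<^sub>m m" and tr: "mat_trace Q = 0" and m: "m > 0"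
  defines "E \<equiv> {v \<in> carrier_vec m. Q *\<^sub>v v = v}"
  shows "VectorSpace.subspace class_ring E (module_vec TYPE(complex) m)"
    and "E \<noteq> {0\<^sub>v m}" and "E \<noteq> carrier_vec m"
proof -
  interpret vec_space "TYPE(complex)" m .
  show "VectorSpace.subspace class_ring E V"
  proof (rule VectorSpace.subspace.intro[OF vec_vs LinearCombinations.submodule.intro])
    show "Module.module class_ring V" by (rule vec_module)
  qed (use Q in \<open>auto simp: E_def mult_add_distrib_mat_vec mult_mat_vec\<close>)
  show "E \<noteq> carrier_vec m"
  proof
    assume "E = carrier_vec m"
    then have "Q = 1\<^sub>m m"
      using Q by (intro mat_eqI_mult_vec[of _ m m]) (auto simp: E_def)
    then show False using tr m by (simp add: mat_trace_def)
  qed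
  show "E \<noteq> {0\<^sub>v m}"
  proof
    assume E: "E = {0\<^sub>v m}"
    have "Q *\<^sub>v v = ((-1) \<cdot>\<^sub>m 1\<^sub>m m) *\<^sub>v v" if v: "v \<in> carrier_vec m" for v
    proof -
      have "Q *\<^sub>v (Q *\<^sub>v v) = v"
        using Q v sq by (simp flip: assoc_mult_mat_vec)
      \<comment> \<open>Since \<open>Q\<close> is an involution, applying it only swaps the two
        summands.\<close>
      then have "Q *\<^sub>v v + v \<in> E"
        using Q v by (simp add: E_def mult_add_distrib_mat_vec comm_add_vec[of v m])
      then have 0: "Q *\<^sub>v v + v = 0\<^sub>v m" using E by simp
      show ?thesis
      proof (rule eq_vecI)
        fix i assume "i < dim_vec (((-1) \<cdot>\<^sub>m 1\<^sub>m m) *\<^sub>v v)"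
        then have i: "i < m" by simp
        have "(Q *\<^sub>v v + v) $ i = 0" using 0 i by simp
        then have "(Q *\<^sub>v v) $ i = - (v $ i)" using i v Q by (simp add: eq_neg_iff_add_eq_0)
        then show "(Q *\<^sub>v v) $ i = (((-1) \<cdot>\<^sub>m 1\<^sub>m m) *\<^sub>v v) $ i"
          using i v by simp
      qed (use Q in auto)
    qed
    then have "Q = (-1) \<cdot>\<^sub>m 1\<^sub>m m"
      using Q by (intro mat_eqI_mult_vec[of _ m m]) auto
    then show False using tr m by (simp add: mat_trace_def)
  qed
qed

text \<open>In an expansion of \<open>H k\<close>, each Pauli operator either has coefficient zero
  or lies in the support, so \<open>Q\<close> commutes with every term.\<close>

lemma commute_model_term:
  assumes model: "hamiltonian_model n M H" and k: "k < M"
    and Q: "Q \<in> pauli_ops n" "\<And>X. X \<in> pauli_support n M H \<Longrightarrow> Q * X = X * Q"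
  shows "Q * H k = H k * Q"
proof -
  let ?N = "2 ^ n :: nat"
  interpret matrix_vs ?N ?N "TYPE(complex)" .
  have "H k \<in> span (pauli_ops_star n)"
    using model k by (simp add: hamiltonian_model_def)
  then obtain a A where A: "finite A" "A \<subseteq> pauli_ops_star n" and H: "H k = lincomb a A"
    unfolding span_def by blast
  have Ap: "A \<subseteq> pauli_ops n" using A(2) by (auto simp: pauli_ops_star_def)
  have car: "(\<lambda>v. a v \<cdot>\<^sub>m v) \<in> A \<rightarrow> carrier_mat ?N ?N"
    using Ap pauli_ops_carrier by auto
  have HA: "H k = finsum V (\<lambda>v. a v \<cdot>\<^sub>m v) A" unfolding H lincomb_def by simp
  have "Q * (a X \<cdot>\<^sub>m X) = (a X \<cdot>\<^sub>m X) * Q" if X: "X \<in> A" for X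
  proof -
    have Xp: "X \<in> pauli_ops n" using X Ap by blast
    note carX = pauli_ops_carrier[OF Xp]
    have "mat_trace (X * (a Y \<cdot>\<^sub>m Y)) = (if X = Y then a X * 2 ^ n else 0)" if Y: "Y \<in> A" for Y
    proof -
      have Yp: "Y \<in> pauli_ops n" using Y Ap by blast
      note carY = pauli_ops_carrier[OF Yp]
      show ?thesis
        using mat_trace_smult[OF mult_carrier_mat[OF carX carY]] pauli_ops_trace_mult[OF Xp Yp]
        by (simp add: mult_smult_distrib[OF carX carY])
    qed
    \<comment> \<open>By orthogonality only the term of \<open>X\<close> itself survives in the
      trace.\<close>
    then have "mat_trace (mat_adjoint X * H k) = a X * 2 ^ n"
      using X A(1) mat_trace_mult_finsum[OF carX A(1) car]
      by (simp add: pauli_ops_adjoint[OF Xp] HA)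
    then have "a X = 0 \<or> X \<in> pauli_support n M H"
      using X A(2) k by (auto simp: pauli_support_def)
    then show ?thesis
    proof
      assume "a X = 0"
      moreover have "0 \<cdot>\<^sub>m X = 0\<^sub>m ?N ?N" using carX by (intro eq_matI) auto
      ultimately show ?thesis using pauli_ops_carrier[OF Q(1)] by simp
    next
      assume "X \<in> pauli_support n M H"
      then show ?thesis
        using Q(2) mult_smult_distrib[OF pauli_ops_carrier[OF Q(1)] carX]
          mult_smult_assoc_mat[OF carX pauli_ops_carrier[OF Q(1)]] by simp
    qed
  qed
  then show ?thesis
    unfolding HA using commute_finsum_mat[OF pauli_ops_carrier[OF Q(1)] A(1) car] by blast
qed

theorem theorem5p5:
  fixes n M :: nat
    and H :: "nat \<Rightarrow> complex mat"
    and \<phi> :: "complex mat \<Rightarrow> bit vec"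
  assumes "n \<ge> 1"
    and "hamiltonian_model n M H"
    and "\<phi> \<in> iso (pauli_group n) (monoid_vec TYPE(bit) (2 * n))"
    and "span_rank (2 * n) (\<phi> ` pauli_support n M H) < 2 * n"
  shows "\<exists>V. VectorSpace.subspace class_ring V (module_vec TYPE(complex) (2 ^ n)) \<and>
           V \<noteq> {0\<^sub>v (2 ^ n)} \<and> V \<noteq> carrier_vec (2 ^ n) \<and>
           (\<forall>l \<in> carrier_vec M. \<forall>v \<in> V. hamiltonian n M H l *\<^sub>v v \<in> V)"
proof -
  let ?N = "2 ^ n :: nat"
  have "pauli_support n M H \<subseteq> pauli_ops n"
    by (auto simp: pauli_support_def pauli_ops_star_def)
  then obtain Q where Q: "Q \<in> pauli_ops n" "mat_trace Q = 0"
    "\<And>X. X \<in> pauli_support n M H \<Longrightarrow> Q * X = X * Q"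
    using exists_pauli_commuting_support[OF assms(3) _ assms(4)] by blast
  note carQ = pauli_ops_carrier[OF Q(1)]
  define E where "E = {v \<in> carrier_vec ?N. Q *\<^sub>v v = v}"
  have "hamiltonian n M H l *\<^sub>v v \<in> E" if v: "v \<in> E" for l v
  proof -
    let ?h = "hamiltonian n M H l"
    have carH: "H k \<in> carrier_mat ?N ?N" if "k < M" for k
      using assms(2) that by (simp add: hamiltonian_model_def)
    then have f: "(\<lambda>k. complex_of_real (l $ k) \<cdot>\<^sub>m H k) \<in> {..<M} \<rightarrow> carrier_mat ?N ?N" by auto
    have h: "?h \<in> carrier_mat ?N ?N"
      unfolding hamiltonian_def by (rule finsum_mat_closed[OF f])
    have comm: "Q * ?h = ?h * Q"
      unfolding hamiltonian_def
    proof (rule commute_finsum_mat[OF carQ _ f])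
      fix k assume "k \<in> {..<M}"
      then have k: "k < M" by simp
      show "Q * (complex_of_real (l $ k) \<cdot>\<^sub>m H k) = complex_of_real (l $ k) \<cdot>\<^sub>m H k * Q"
        using commute_model_term[OF assms(2) k Q(1,3)]
          mult_smult_distrib[OF carQ carH[OF k]] mult_smult_assoc_mat[OF carH[OF k] carQ] by simp
    qed simp
    have v': "v \<in> carrier_vec ?N" "Q *\<^sub>v v = v" using v by (auto simp: E_def)
    \<comment> \<open>An operator commuting with \<open>Q\<close> maps vectors fixed by
      \<open>Q\<close> to vectors fixed by \<open>Q\<close>.\<close>
    have "Q *\<^sub>v (?h *\<^sub>v v) = (Q * ?h) *\<^sub>v v"
      using assoc_mult_mat_vec[OF carQ h v'(1)] by simp
    also have "\<dots> = ?h *\<^sub>v v"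
      unfolding comm using assoc_mult_mat_vec[OF h carQ v'(1)] v'(2) by simp
    finally show ?thesis using h v'(1) by (simp add: E_def)
  qed
  then show ?thesis
    using involution_eigenspace[OF carQ pauli_ops_square[OF Q(1)] Q(2)]
    unfolding E_def by (intro exI[of _ "{v \<in> carrier_vec ?N. Q *\<^sub>v v = v}"]) simp
qed

end
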